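(* Let $E$ be a complex Banach space with open unit ball $B_E$, and let $f:B_E\to\mathbb{C}$ be a bounded holomorphic function with $\|f\|_\infty=\sup_{x\in B_E}|f(x)|\le 1$. Then for every $x_0\in B_E$, $$(1-\|x_0\|)\,\|f'(x_0)\|\le 1-|f(x_0)|^2.$$
   Context: Holomorphic means complex Fréchet differentiable at every point of $B_E$; $f'(x_0)\in E^*$ is the Fréchet derivative and $\|f'(x_0)\|$ its dual norm. *)

theory Defs
  imports "HOL-Analysis.Analysis"
begin

class complex_banach = banach +
  fixes scaleC :: "complex \<Rightarrow> 'a \<Rightarrow> 'a"  (infixr "*\<^sub>C" 75)
  assumes scaleC_add_right: "a *\<^sub>C (x + y) = a *\<^sub>C x + a *\<^sub>C y"
    and scaleC_add_left: "(a + b) *\<^sub>C x = a *\<^sub>C x + b *\<^sub>C x"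
    and scaleC_scaleC: "a *\<^sub>C b *\<^sub>C x = (a * b) *\<^sub>C x"
    and scaleC_one: "1 *\<^sub>C x = x"
    and norm_scaleC: "norm (a *\<^sub>C x) = cmod a * norm x"
    and scaleR_scaleC: "scaleR r x = complex_of_real r *\<^sub>C x"

lemma vector_space_scaleC: "vector_space (scaleC :: complex \<Rightarrow> 'a::complex_banach \<Rightarrow> 'a)"
  by unfold_locales
    (simp_all add: scaleC_add_right scaleC_add_left scaleC_scaleC scaleC_one)

instantiation complex :: complex_banach
begin

definition scaleC_complex :: "complex \<Rightarrow> complex \<Rightarrow> complex" where
  "scaleC_complex a x = a * x"

instance
  by standard (simp_all add: scaleC_complex_def algebra_simps norm_mult scaleR_conv_of_real)

end

text \<open>
  A complex Frechet derivative is a real Frechet derivative (in particular a bounded map)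
  that is moreover linear over the complex numbers.
\<close>

definition has_complex_frechet_derivative ::
    "('a::complex_banach \<Rightarrow> complex) \<Rightarrow> ('a \<Rightarrow> complex) \<Rightarrow> 'a \<Rightarrow> bool" where
  "has_complex_frechet_derivative f D x \<longleftrightarrow>
     (f has_derivative D) (at x) \<and> Vector_Spaces.linear scaleC (*) D"

text \<open>Only meant for open \<open>S\<close>, as the derivative is taken in the whole space.\<close>

definition frechet_holomorphic_on ::
    "('a::complex_banach \<Rightarrow> complex) \<Rightarrow> 'a set \<Rightarrow> bool" where
  "frechet_holomorphic_on f S \<longleftrightarrow> (\<forall>x\<in>S. \<exists>D. has_complex_frechet_derivative f D x)"

text \<open>
  By uniqueness of derivatives, the complex derivative of a holomorphic function is the one
  selected by \<^const>\<open>frechet_derivative\<close>; its dual norm is its \<^const>\<open>onorm\<close>.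
\<close>

lemma has_complex_frechet_derivative_unique:
  assumes "has_complex_frechet_derivative f D x"
  shows "frechet_derivative f (at x) = D"
  using assms frechet_derivative_at[of f D x] by (simp add: has_complex_frechet_derivative_def)

end

theory Submission
  imports Defs "HOL-Complex_Analysis.Riemann_Mapping"
begin

text \<open>
  Restrict \<open>f\<close> to a complex disc of radius \<open>1 - norm x0\<close> centred at \<open>x0\<close>, in the direction of
  an arbitrary vector \<open>v\<close>: this gives a holomorphic self-map \<open>g\<close> of the closed unit disc whose
  derivative at \<open>0\<close> is \<open>(1 - norm x0) / norm v\<close> times the value of the differential at \<open>v\<close>.
  The Schwarz--Pick inequality at the origin bounds that derivative by \<open>1 - (cmod (g 0))\<^sup>2\<close>.
\<close>

text \<open>The map is z \<mapsto> (z - w) / (1 - cnj w * z). Its numerator vanishes at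
  \<open>w\<close>, so in the quotient rule only the derivative of the numerator survives.\<close>

lemma Moebius_function_has_field_derivative_self:
  assumes "cmod w < 1"
  shows "(Moebius_function 0 w has_field_derivative 1 / (1 - (cmod w)\<^sup>2)) (at w)"
proof -
  have w: "cnj w * w = of_real ((cmod w)\<^sup>2)"
    by (metis complex_norm_square mult.commute of_real_power)
  have "(cmod w)\<^sup>2 < 1"
    using assms by (simp add: power_less_one_iff abs_square_less_1)
  then have "1 - of_real ((cmod w)\<^sup>2) \<noteq> (0::complex)"
    by (metis eq_iff_diff_eq_0 less_irrefl of_real_1 of_real_eq_iff)
  then have nz: "1 - cnj w * w \<noteq> 0"
    using w by simp
  show ?thesis
    unfolding Moebius_function_simple [abs_def]
    by (rule derivative_eq_intros refl nz)+ (use nz w in simp)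
qed

text \<open>The Moebius map \<open>?M\<close> sends \<open>g 0\<close> to 0, so the Schwarz lemma
  bounds the derivative of \<open>?M \<circ> g\<close> at 0 by 1. By the chain rule that derivative
  is \<open>deriv g 0\<close> divided by 1 - |g 0|^2. Strictness of \<open>lt1\<close> keeps the
  values of \<open>g\<close> in the open disc, where \<open>?M\<close> is holomorphic.\<close>

lemma Schwarz_Pick_at_0_strict:
  assumes holg: "g holomorphic_on ball 0 1"
    and lt1: "\<And>z. cmod z < 1 \<Longrightarrow> cmod (g z) < 1"
  shows "cmod (deriv g 0) \<le> 1 - (cmod (g 0))\<^sup>2"
proof -
  let ?M = "Moebius_function 0 (g 0)"
  have g0: "cmod (g 0) < 1"
    using lt1 by simp
  then have pos: "1 - (cmod (g 0))\<^sup>2 > 0"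
    by (simp add: abs_square_less_1)
  have "(?M \<circ> g) holomorphic_on ball 0 1"
    using holg Moebius_function_holomorphic [OF g0] lt1
    by (intro holomorphic_on_compose_gen [where t = "ball 0 1"]) auto
  moreover have "cmod ((?M \<circ> g) z) < 1" if "cmod z < 1" for z
    using Moebius_function_norm_lt_1 g0 lt1 that by simp
  ultimately have "cmod (deriv (?M \<circ> g) 0) \<le> 1"
    by (intro Schwarz_Lemma(2) [where \<xi> = 0]) (auto simp: Moebius_function_eq_zero)
  moreover have "(g has_field_derivative deriv g 0) (at 0)"
    using holg by (intro holomorphic_derivI [of _ "ball 0 1"]) auto
  then have "deriv (?M \<circ> g) 0 = 1 / (1 - (cmod (g 0))\<^sup>2) * deriv g 0"
    by (intro DERIV_imp_deriv DERIV_chain Moebius_function_has_field_derivative_self g0)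
  ultimately have "cmod (of_real (1 / (1 - (cmod (g 0))\<^sup>2)) * deriv g 0) \<le> 1"
    by simp
  then have "\<bar>1 / (1 - (cmod (g 0))\<^sup>2)\<bar> * cmod (deriv g 0) \<le> 1"
    by (simp only: norm_mult norm_of_real)
  then show ?thesis
    using pos by (simp add: field_simps)
qed

text \<open>Values of modulus 1 are allowed here. For 0 < c < 1 the function c * g maps into the
  open disc, so the strict version applies to it; letting c tend to 1 from the left gives the
  claim.\<close>

lemma Schwarz_Pick_at_0:
  assumes holg: "g holomorphic_on ball 0 1"
    and le1: "\<And>z. cmod z < 1 \<Longrightarrow> cmod (g z) \<le> 1"
  shows "cmod (deriv g 0) \<le> 1 - (cmod (g 0))\<^sup>2"
proof (rule tendsto_le)
  have ev: "eventually (\<lambda>c::real. c \<in> {0<..<1}) (at_left 1)"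
    by (rule eventually_at_left_real) simp
  show "eventually (\<lambda>c. c * cmod (deriv g 0) \<le> 1 - (c * cmod (g 0))\<^sup>2) (at_left (1::real))"
    using ev
  proof eventually_elim
    case (elim c)
    have "cmod (of_real c * g z) < 1" if "cmod z < 1" for z
    proof -
      have "c * cmod (g z) \<le> c * 1"
        using elim le1 [OF that] by (intro mult_left_mono) auto
      also have "\<dots> < 1"
        using elim by simp
      finally show ?thesis
        using elim by (simp add: norm_mult)
    qed
    then have "cmod (deriv (\<lambda>z. of_real c * g z) 0) \<le> 1 - (cmod (of_real c * g 0))\<^sup>2"
      using holg by (intro Schwarz_Pick_at_0_strict holomorphic_intros) auto
    moreover have "deriv (\<lambda>z. of_real c * g z) 0 = of_real c * deriv g 0"
      using holg by (intro deriv_cmult holomorphic_on_imp_differentiable_at [of _ "ball 0 1"]) auto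
    ultimately show ?case
      using elim by (simp add: norm_mult)
  qed
  have "((\<lambda>c. 1 - (c * cmod (g 0))\<^sup>2) \<longlongrightarrow> 1 - (1 * cmod (g 0))\<^sup>2) (at_left 1)"
    by (intro tendsto_intros)
  then show "((\<lambda>c. 1 - (c * cmod (g 0))\<^sup>2) \<longlongrightarrow> 1 - (cmod (g 0))\<^sup>2) (at_left 1)"
    by simp
  have "((\<lambda>c. c * cmod (deriv g 0)) \<longlongrightarrow> 1 * cmod (deriv g 0)) (at_left 1)"
    by (intro tendsto_intros)
  then show "((\<lambda>c. c * cmod (deriv g 0)) \<longlongrightarrow> cmod (deriv g 0)) (at_left 1)"
    by simp
qed simp

lemma bounded_linear_scaleC_left: "bounded_linear (\<lambda>z. z *\<^sub>C (v::'a::complex_banach))"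
proof (rule bounded_linear_intro [where K = "norm v"])
  show "(r *\<^sub>R z) *\<^sub>C v = r *\<^sub>R (z *\<^sub>C v)" for r z
    by (simp add: scaleR_scaleC scaleC_scaleC scaleC_complex_def)
qed (simp_all add: scaleC_add_left norm_scaleC)

text \<open>The chain rule yields the real derivative z \<mapsto> D (z v). Complex linearity of
  \<open>D\<close> makes it multiplication by the number \<open>D v\<close>, which is what complex
  differentiability in z demands.\<close>

lemma has_complex_frechet_derivative_line:
  fixes f :: "'a::complex_banach \<Rightarrow> complex"
  assumes "has_complex_frechet_derivative f D (x + z *\<^sub>C v)"
  shows "((\<lambda>z. f (x + z *\<^sub>C v)) has_field_derivative D v) (at z)"
proof -
  interpret D: Vector_Spaces.linear scaleC "(*)" D
    using assms by (simp add: has_complex_frechet_derivative_def)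
  have "((\<lambda>z. x + z *\<^sub>C v) has_derivative (\<lambda>z. z *\<^sub>C v)) (at z)"
    by (rule has_derivative_eq_rhs, rule has_derivative_add,
        rule has_derivative_const,
        rule bounded_linear_imp_has_derivative [OF bounded_linear_scaleC_left]) simp
  then have "((\<lambda>z. f (x + z *\<^sub>C v)) has_derivative (\<lambda>z. D (z *\<^sub>C v))) (at z)"
    by (rule has_derivative_compose) (use assms in \<open>simp add: has_complex_frechet_derivative_def\<close>)
  then show ?thesis
    by (simp add: has_field_derivative_def D.scale mult.commute [of _ "D v"])
qed

theorem proposition3p3:
  fixes f :: "'a::complex_banach \<Rightarrow> complex" and x0 :: 'a
  assumes "frechet_holomorphic_on f (ball 0 1)"
    and "bounded (f ` ball 0 1)"
    and "(SUP x\<in>ball 0 1. cmod (f x)) \<le> 1"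
    and "x0 \<in> ball 0 1"
  shows "(1 - norm x0) * onorm (frechet_derivative f (at x0)) \<le> 1 - (cmod (f x0))\<^sup>2"
proof -
  define r where "r = 1 - norm x0"
  have r: "r > 0"
    using assms(4) by (simp add: r_def)
  \<comment> \<open>A real supremum is known to dominate the values only when they are bounded
    above; this is where boundedness of \<open>f\<close> enters.\<close>
  have "bdd_above ((\<lambda>x. cmod (f x)) ` ball 0 1)"
    using assms(2) by (auto simp: bounded_iff bdd_above_def)
  then have le1: "cmod (f x) \<le> 1" if "x \<in> ball 0 1" for x
    using cSUP_upper [OF that] assms(3) by fastforce
  obtain D where D: "has_complex_frechet_derivative f D x0"
    using assms(1,4) unfolding frechet_holomorphic_on_def by blast
  interpret D: Vector_Spaces.linear scaleC "(*)" D
    using D by (simp add: has_complex_frechet_derivative_def)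
  \<comment> \<open>A bound proportional to \<open>norm v\<close> in every direction is what bounds
    the dual norm of \<open>D\<close>.\<close>
  have bound: "cmod (D v) \<le> (1 - (cmod (f x0))\<^sup>2) / r * norm v" for v
  proof (cases "v = 0")
    case False
    \<comment> \<open>The scaling gives \<open>u\<close> norm r = 1 - norm x0, the largest norm for
      which the triangle inequality keeps \<open>x0 + z *\<^sub>C u\<close> in the unit ball for all
      |z| < 1.\<close>
    define s where "s = r / norm v"
    have s: "s > 0" "s * norm v = r"
      using False r by (simp_all add: s_def)
    define u where "u = complex_of_real s *\<^sub>C v"
    define g where "g z = f (x0 + z *\<^sub>C u)" for z
    have norm_u: "norm u = r"
      using s by (simp add: u_def norm_scaleC)
    have in_ball: "x0 + z *\<^sub>C u \<in> ball 0 1" if "cmod z < 1" for z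
    proof -
      have "norm (x0 + z *\<^sub>C u) \<le> norm x0 + cmod z * r"
        using norm_triangle_ineq [of x0 "z *\<^sub>C u"] by (simp add: norm_scaleC norm_u)
      also have "\<dots> < norm x0 + r"
        using that r by simp
      finally show ?thesis
        by (simp add: r_def)
    qed
    have at0: "x0 + 0 *\<^sub>C u = x0"
      using linear_0 [OF bounded_linear.linear [OF bounded_linear_scaleC_left [of u]]] by simp
    have "g field_differentiable at z" if "cmod z < 1" for z
      using assms(1) in_ball [OF that] has_complex_frechet_derivative_line [of f _ x0 z u]
      unfolding g_def [abs_def] field_differentiable_def frechet_holomorphic_on_def by blast
    then have "g holomorphic_on ball 0 1"
      by (auto simp: holomorphic_on_def intro: field_differentiable_at_within)
    then have "cmod (deriv g 0) \<le> 1 - (cmod (g 0))\<^sup>2"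
      by (rule Schwarz_Pick_at_0) (use in_ball le1 g_def in auto)
    moreover have "deriv g 0 = D u"
      unfolding g_def [abs_def] using D at0
      by (intro DERIV_imp_deriv has_complex_frechet_derivative_line) simp
    \<comment> \<open>Complex linearity gives D u = s * D v, and g 0 = f x0.\<close>
    ultimately have "s * cmod (D v) \<le> 1 - (cmod (f x0))\<^sup>2"
      using s at0 by (simp add: g_def u_def D.scale norm_mult)
    then show ?thesis
      using False r by (simp add: s_def field_simps)
  qed (simp add: D.zero)
  have "onorm D \<le> (1 - (cmod (f x0))\<^sup>2) / r"
  proof (rule onorm_bound [OF _ bound])
    \<comment> \<open>The rule \<open>onorm_bound\<close> also asks for a nonnegative
      constant.\<close>
    have "(cmod (f x0))\<^sup>2 \<le> 1"
      using le1 [OF assms(4)] by (simp add: abs_square_le_1)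
    then show "0 \<le> (1 - (cmod (f x0))\<^sup>2) / r"
      using r by simp
  qed
  then show ?thesis
    using r has_complex_frechet_derivative_unique [OF D] by (simp add: r_def field_simps)
qed

end
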